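(* Let $(\mathcal A^*,d,\cdot,\langle-,-\rangle)$ be a Poincar\'e DGCA of degree $n$ over a field $\mathbb F$ of characteristic zero, equipped with a Hodge homotopy $d^-$ with harmonic subspace $\mathcal H^*$. Then the transferred minimal $C_\infty$-algebra $C_\infty(\mathcal H^* )=(\mathcal H^*,m_1=0,m_2,m_3,\dots)$ associated with $d^-$ is unital and cyclic. More precisely, under the convention that the cyclic generator $z(k)=(0,1,\dots,k)\in\mathbb S_{k+1}$ acts on $m_k$ by $m_k^{z(k)}=(-1)^km_k$, one has for every $k\ge 2$ $$\langle m_k(x_1,\dots,x_k),x_{k+1}\rangle=(-1)^k(-1)^{\epsilon}\langle m_k(x_2,\dots,x_{k+1}),x_1\rangle$$ for all homogeneous $x_1,\dots,x_{k+1}\in\mathcal H^*$, where $\epsilon=|x_1|(|x_2|+\cdots+|x_{k+1}|)$.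
   Context: A Poincar\'e DGCA (PDGCA) of degree $n$ over $\mathbb F$ is a unital differential graded commutative algebra $\mathcal A^*=\bigoplus_{k=0}^n\mathcal A^k$ with finite-dimensional cohomology $H^*(\mathcal A)$ and a linear functional $\int\colon H^n(\mathcal A)\to\mathbb F$ such that $\langle\alpha,\beta\rangle=\int\alpha\cdot\beta$ if $|\alpha|+|\beta|=n$, and $0$ otherwise, is nondegenerate on $H^*(\mathcal A)$. It induces a pairing on $\mathcal A^*$ by $\langle\alpha,\beta\rangle=\int[\alpha\cdot\beta]$ if $|\alpha|+|\beta|=n$, and $0$ otherwise; this pairing on $\mathcal A^*$ is not required to be nondegenerate, nor is $H^1(\mathcal A)=0$ assumed. A Hodge homotopy is a degree $-1$ linear operator $d^-\colon\mathcal A^*\to\mathcal A^{*-1}$ with $(d^-)^2=0$, $d^-dd^-=d^-$, $dd^-d=d$, $\langle\operatorname{Im}d^-,\operatorname{Im}d^-\rangle=0$ and $\langle\operatorname{Im}\pi_{\mathcal H^*},\operatorname{Im}d^-\rangle=0$, where $\pi_{\mathcal H^*}=\mathrm{id}-dd^--d^-d$; the harmonic subspace is $\mathcal H^*=\operatorname{Im}\pi_{\mathcal H^*}$, with the restricted pairing. It contains the unit $1\in\mathcal A^0$. The transferred minimal $C_\infty$-algebra is obtained by homotopy transfer of the DGCA structure along the contraction $(\mathcal H^*\hookrightarrow\mathcal A^*,\pi_{\mathcal H^*},d^-)$. Explicitly $m_k=\pi_{\mathcal H^*}\circ\widehat m_k$ on $\mathcal H^*$, where $\widehat m_2(\alpha_1,\alpha_2)=\alpha_1\cdot\alpha_2$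 and for $k\ge3$ $$\begin{aligned}\widehat m_k(\alpha_1,\dots,\alpha_k)={}&(-1)^{k-1}d^-\widehat m_{k-1}(\alpha_1,\dots,\alpha_{k-1})\cdot\alpha_k-(-1)^{k|\alpha_1|}\alpha_1\cdot d^-\widehat m_{k-1}(\alpha_2,\dots,\alpha_k)\\&-\sum_{i=2}^{k-2}(-1)^{\nu}d^-\widehat m_i(\alpha_1,\dots,\alpha_i)\cdot d^-\widehat m_{k-i}(\alpha_{i+1},\dots,\alpha_k),\end{aligned}$$ with $\nu=i+(k-i-1)(|\alpha_1|+\cdots+|\alpha_i|)$ (the sum is empty for $k=3$). Unital means strictly unital: $m_2(1,\alpha)=m_2(\alpha,1)=\alpha$, and for every $k\ge3$, $m_k(\alpha_1,\dots,\alpha_k)=0$ whenever some $\alpha_i=1$. *)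

theory Defs
  imports Complex_Main
begin

text \<open>
  The graded vector space is the whole type \<open>'a\<close>, with homogeneous components \<open>A k\<close> for integer
  \<open>k\<close>, so that operators of negative degree need no truncated subtraction. The sort
  \<open>{ring, monoid_mult}\<close> is that of unital rings in which \<open>1 = 0\<close> is allowed (unlike \<open>ring_1\<close>).
\<close>

locale dgca = vector_space scale
  for scale :: "'f::field_char_0 \<Rightarrow> 'a::{ring, monoid_mult} \<Rightarrow> 'a" (infixr "*s" 75) +
  fixes n :: nat
    and A :: "int \<Rightarrow> 'a set"
    and d :: "'a \<Rightarrow> 'a"
  assumes subspace_grading: "subspace (A k)"
    and grading_outside: "k < 0 \<or> k > int n \<Longrightarrow> A k = {0}"
    and direct_sum: "\<exists>!f. (\<forall>k. f k \<in> A k) \<and> x = (\<Sum>k=0..int n. f k)"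
    and scale_mult_left: "(c *s x) * y = c *s (x * y)"
    and scale_mult_right: "x * (c *s y) = c *s (x * y)"
    and one_degree: "1 \<in> A 0"
    and mult_degree: "x \<in> A i \<Longrightarrow> y \<in> A j \<Longrightarrow> x * y \<in> A (i + j)"
    and graded_commutative:
      "x \<in> A i \<Longrightarrow> y \<in> A j \<Longrightarrow> y * x = ((-1) powi (i * j)) *s (x * y)"
    and linear_d: "Vector_Spaces.linear scale scale d"
    and d_degree: "x \<in> A k \<Longrightarrow> d x \<in> A (k + 1)"
    and d_square: "d (d x) = 0"
    and Leibniz: "x \<in> A i \<Longrightarrow> d (x * y) = d x * y + ((-1) powi i) *s (x * d y)"
begin

definition component :: "int \<Rightarrow> 'a \<Rightarrow> 'a" where
  "component i x = (THE f. (\<forall>k. f k \<in> A k) \<and> x = (\<Sum>k=0..int n. f k)) i"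

definition cocycles :: "'a set" where
  "cocycles = {x. d x = 0}"

text \<open>Elements of cohomology are the cosets of the coboundaries in the cocycles.\<close>

definition coh_class :: "'a \<Rightarrow> 'a set" where
  "coh_class x = {x + d y | y. True}"

definition finite_dim_cohomology :: bool where
  "finite_dim_cohomology \<longleftrightarrow>
     (\<exists>S. finite S \<and> S \<subseteq> cocycles \<and> coh_class ` cocycles = coh_class ` span S)"

text \<open>
  The pairing on the algebra, bilinearly extended from homogeneous elements. Products of degree
  \<open>n\<close> are cocycles because \<open>A (n + 1) = {0}\<close>, so the integral, a function on cohomology
  classes of degree \<open>n\<close>, can be applied to their classes.
\<close>

definition pairing :: "('a set \<Rightarrow> 'f) \<Rightarrow> 'a \<Rightarrow> 'a \<Rightarrow> 'f" where
  "pairing integral x y =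
     (\<Sum>i=0..int n. integral (coh_class (component i x * component (int n - i) y)))"

definition harmonic_proj :: "('a \<Rightarrow> 'a) \<Rightarrow> 'a \<Rightarrow> 'a" where
  "harmonic_proj h x = x - d (h x) - h (d x)"

definition harmonic :: "('a \<Rightarrow> 'a) \<Rightarrow> 'a set" where
  "harmonic h = range (harmonic_proj h)"

text \<open>
  The operations \<open>m\<^sub>k\<close>-hat on homogeneous arguments, each given together with its degree.
  On lists of length less than 2 the value \<open>0\<close> is a convention, which yields \<open>m\<^sub>1 = 0\<close> below.
\<close>

function mhat :: "('a \<Rightarrow> 'a) \<Rightarrow> (int \<times> 'a) list \<Rightarrow> 'a" where
  "mhat h xs =
    (if length xs < 2 then 0
     else if length xs = 2 then snd (xs ! 0) * snd (xs ! 1)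
     else
       ((-1) ^ (length xs - 1)) *s
          (h (mhat h (take (length xs - 1) xs)) * snd (last xs))
       - ((-1) powi (int (length xs) * fst (hd xs))) *s
          (snd (hd xs) * h (mhat h (drop 1 xs)))
       - (\<Sum>i=2..length xs - 2.
           ((-1) powi (int i + (int (length xs) - int i - 1) * sum_list (map fst (take i xs)))) *s
             (h (mhat h (take i xs)) * h (mhat h (drop i xs)))))"
  by pat_completeness auto
termination
  by (relation "measure (\<lambda>(h, xs). length xs)") auto

declare mhat.simps [simp del]

text \<open>
  The transferred operations, with the arity given by the length of the argument list: the
  multilinear extension of \<open>mhat\<close> to arbitrary elements, followed by the harmonic projection.
\<close>

definition transferred :: "('a \<Rightarrow> 'a) \<Rightarrow> 'a list \<Rightarrow> 'a" where
  "transferred h xs =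
     harmonic_proj h
       (\<Sum>ds | length ds = length xs \<and> set ds \<subseteq> {0..int n}.
          mhat h (map2 (\<lambda>i x. (i, component i x)) ds xs))"

text \<open>
  Multilinear operations \<open>m\<^sub>k\<close> of degree \<open>2 - k\<close> on the graded subspace \<open>V\<close>, with \<open>m\<^sub>1 = 0\<close>.
\<close>

definition minimal_operations :: "'a set \<Rightarrow> ('a list \<Rightarrow> 'a) \<Rightarrow> bool" where
  "minimal_operations V m \<longleftrightarrow>
     subspace V \<and>
     (\<forall>xs. xs \<noteq> [] \<and> set xs \<subseteq> V \<longrightarrow> m xs \<in> V) \<and>
     (\<forall>x\<in>V. m [x] = 0) \<and>
     (\<forall>us vs x y. set us \<union> set vs \<union> {x, y} \<subseteq> V \<longrightarrow>
        m (us @ [x + y] @ vs) = m (us @ [x] @ vs) + m (us @ [y] @ vs)) \<and>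
     (\<forall>us vs x c. set us \<union> set vs \<union> {x} \<subseteq> V \<longrightarrow>
        m (us @ [c *s x] @ vs) = c *s m (us @ [x] @ vs)) \<and>
     (\<forall>xs ds. xs \<noteq> [] \<and> list_all2 (\<lambda>x i. x \<in> V \<inter> A i) xs ds \<longrightarrow>
        m xs \<in> A (sum_list ds + 2 - int (length xs)))"

definition strictly_unital :: "'a set \<Rightarrow> ('a list \<Rightarrow> 'a) \<Rightarrow> bool" where
  "strictly_unital V m \<longleftrightarrow>
     1 \<in> V \<and>
     (\<forall>x\<in>V. m [1, x] = x \<and> m [x, 1] = x) \<and>
     (\<forall>xs. length xs \<ge> 3 \<and> set xs \<subseteq> V \<and> 1 \<in> set xs \<longrightarrow> m xs = 0)"

text \<open>
  Invariance of the cyclic generator \<open>z(k) = (0, 1, \<dots>, k)\<close> acting on \<open>m\<^sub>k\<close> with sign \<open>(-1)\<^sup>k\<close>;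
  the remaining sign is the Koszul sign of moving \<open>x\<^sub>1\<close> past the other arguments.
\<close>

definition cyclic :: "('a \<Rightarrow> 'a \<Rightarrow> 'f) \<Rightarrow> 'a set \<Rightarrow> ('a list \<Rightarrow> 'a) \<Rightarrow> bool" where
  "cyclic B V m \<longleftrightarrow>
     (\<forall>k\<ge>2. \<forall>x \<delta>. (\<forall>i\<in>{1..k+1}. x i \<in> V \<inter> A (\<delta> i)) \<longrightarrow>
        B (m (map x [1..<k+1])) (x (k+1)) =
          (-1) ^ k * (-1) powi (\<delta> 1 * (\<Sum>i=2..k+1. \<delta> i)) *
            B (m (map x [2..<k+2])) (x 1))"

end

locale poincare_dgca = dgca +
  fixes integral :: "'b set \<Rightarrow> 'a"
  assumes finite_dim: "finite_dim_cohomology"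
    and integral_add: "x \<in> A (int n) \<Longrightarrow> y \<in> A (int n) \<Longrightarrow>
      integral (coh_class (x + y)) = integral (coh_class x) + integral (coh_class y)"
    and integral_scale: "x \<in> A (int n) \<Longrightarrow> integral (coh_class (c *s x)) = c * integral (coh_class x)"
    and nondegenerate_left:
      "x \<in> cocycles \<Longrightarrow> (\<And>y. y \<in> cocycles \<Longrightarrow> pairing integral x y = 0) \<Longrightarrow>
        coh_class x = coh_class 0"
    and nondegenerate_right:
      "y \<in> cocycles \<Longrightarrow> (\<And>x. x \<in> cocycles \<Longrightarrow> pairing integral x y = 0) \<Longrightarrow>
        coh_class y = coh_class 0"

locale hodge_homotopy = poincare_dgca +
  fixes h :: "'b \<Rightarrow> 'b"
  assumes linear_h: "Vector_Spaces.linear scale scale h"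
    and h_degree: "x \<in> A k \<Longrightarrow> h x \<in> A (k - 1)"
    and h_square: "h (h x) = 0"
    and h_d_h: "h (d (h x)) = h x"
    and d_h_d: "d (h (d x)) = d x"
    and h_h_orthogonal: "pairing integral (h x) (h y) = 0"
    and harmonic_h_orthogonal: "pairing integral (harmonic_proj h x) (h y) = 0"

end

theory Submission
  imports Defs
begin

text \<open>
  The operations \<open>m\<^sub>k\<close> are sums over planar binary trees whose inner edges carry \<open>h\<close>. Two observations
  reduce everything to short computations.

  Put \<open>p [x] = - x\<close> for a single argument and \<open>p xs = h (mhat h xs)\<close> for at least two
  (\<open>propagate\<close> below). With this sign the three kinds of terms in the recursion obey one formula:
  \<open>mhat\<close> of a list is the signed sum, over all ways to cut the list into two nonempty pieces, of the
  products of the values of \<open>p\<close> on the pieces (\<open>mhat_splittings\<close>). Multilinearity and the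
  degree follow by induction on the length. So does strict unitality: cutting at a unit turns an
  operation into a value of \<open>h\<close>, which both \<open>h\<close> and the harmonic projection annihilate, and
  every longer piece containing a unit contributes zero (\<open>mhat_unit\<close>).

  For cyclicity, the projection can be dropped under the pairing with a harmonic element. Let \<open>V i j\<close>
  be the integral of the product of the values of \<open>p\<close> on the three pieces into which \<open>k + 1\<close>
  arguments are cut after positions \<open>i\<close> and \<open>j\<close>, where \<open>1 \<le> i < j \<le> k\<close>. By the recursion, the signed
  sum of column \<open>j\<close> is the pairing of \<open>mhat\<close> of the first \<open>j\<close> arguments with \<open>p\<close> of the others,
  and the signed sum of row \<open>i\<close> is the pairing of \<open>p\<close> of the first \<open>i\<close> arguments with \<open>mhat\<close> of
  the others. As \<open>h\<close> is self-adjoint up to sign (\<open>form_h_adjoint\<close>, a consequence of Stokes' theorem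
  and the two orthogonality conditions), row \<open>m\<close> and column \<open>m\<close> have the same sum for \<open>1 < m < k\<close>,
  once rows and columns are multiplied by signs that give each \<open>V i j\<close> the same sign in both counts.
  Column \<open>1\<close> and row \<open>k\<close> are empty. Since all rows together and all columns together have the same
  total, column \<open>k\<close> and row \<open>1\<close> also agree, and this is the asserted cyclic symmetry
  (\<open>mhat_cyclic\<close>).
\<close>

section \<open>Linear maps\<close>

context dgca
begin

abbreviation lin :: "('a \<Rightarrow> 'a) \<Rightarrow> bool" where
  "lin f \<equiv> Vector_Spaces.linear scale scale f"

lemma linI:
  assumes "\<And>x y. f (x + y) = f x + f y" "\<And>c x. f (c *s x) = c *s f x"
  shows "lin f"
  using assms vector_space_axioms by (simp add: Vector_Spaces.linear_iff)

lemma
  assumes "lin f"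
  shows lin_add: "f (x + y) = f x + f y"
    and lin_scale: "f (c *s x) = c *s f x"
    and lin_zero: "f 0 = 0"
    and lin_diff: "f (x - y) = f x - f y"
    and lin_sum: "f (sum g S) = (\<Sum>a\<in>S. f (g a))"
proof -
  interpret module_hom scale scale f
    using assms by (simp add: linear_iff_module_hom)
  show "f (x + y) = f x + f y" "f (c *s x) = c *s f x" "f 0 = 0"
    "f (x - y) = f x - f y" "f (sum g S) = (\<Sum>a\<in>S. f (g a))"
    by (fact add scale zero diff sum)+
qed

lemma lin_compose: "lin f \<Longrightarrow> lin g \<Longrightarrow> lin (\<lambda>x. f (g x))"
  by (rule linI) (simp_all add: lin_add lin_scale)

lemma lin_scaled: "lin f \<Longrightarrow> lin (\<lambda>x. c *s f x)"
  by (rule linI) (simp_all add: lin_add lin_scale scale_right_distrib mult.commute)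

lemma lin_minus: "lin f \<Longrightarrow> lin (\<lambda>x. - f x)"
  by (rule linI) (simp_all add: lin_add lin_scale)

lemma lin_sum_fun:
  assumes "\<And>i. i \<in> I \<Longrightarrow> lin (f i)"
  shows "lin (\<lambda>x. \<Sum>i\<in>I. f i x)"
  by (rule linI) (use assms in \<open>simp_all add: lin_add lin_scale sum.distrib scale_sum_right\<close>)

abbreviation functional :: "('a \<Rightarrow> 'f) \<Rightarrow> bool" where
  "functional f \<equiv> Vector_Spaces.linear scale (*) f"

lemma functionalI:
  assumes "\<And>x y. f (x + y) = f x + f y" "\<And>c x. f (c *s x) = c * f x"
  shows "functional f"
proof -
  have "vector_space ((*) :: 'f \<Rightarrow> 'f \<Rightarrow> 'f)"
    by unfold_locales (auto simp: algebra_simps)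
  then show ?thesis
    using assms vector_space_axioms by (simp add: Vector_Spaces.linear_iff)
qed

lemma
  assumes "functional f"
  shows functional_add: "f (x + y) = f x + f y"
    and functional_scale: "f (c *s x) = c * f x"
    and functional_zero: "f 0 = 0"
    and functional_neg: "f (- x) = - f x"
    and functional_diff: "f (x - y) = f x - f y"
    and functional_sum: "f (sum g S) = (\<Sum>a\<in>S. f (g a))"
proof -
  interpret module_hom scale "(*)" f
    using assms by (simp add: linear_iff_module_hom)
  show "f (x + y) = f x + f y" "f (c *s x) = c * f x" "f 0 = 0" "f (- x) = - f x"
    "f (x - y) = f x - f y" "f (sum g S) = (\<Sum>a\<in>S. f (g a))"
    by (fact add scale zero neg diff sum)+
qed

end

section \<open>Homogeneous components\<close>

context dgca
begin

lemma component_unique: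
  assumes "\<And>k. f k \<in> A k" "x = (\<Sum>k=0..int n. f k)"
  shows "component i x = f i"
proof -
  have "(THE f. (\<forall>k. f k \<in> A k) \<and> x = (\<Sum>k=0..int n. f k)) = f"
    using direct_sum[of x] assms by (intro the1_equality) auto
  then show ?thesis
    by (simp add: component_def)
qed

lemma component_mem: "component k x \<in> A k"
  and sum_component: "(\<Sum>k=0..int n. component k x) = x"
proof -
  obtain f where f: "\<And>k. f k \<in> A k" "x = (\<Sum>k=0..int n. f k)"
    using direct_sum[of x] by blast
  have "component k x = f k" for k
    using component_unique f by blast
  then show "component k x \<in> A k" "(\<Sum>k=0..int n. component k x) = x"
    using f by auto
qed

lemma zero_mem [simp]: "0 \<in> A k"
  using subspace_0[OF subspace_grading] .

lemma degree_outside: "x \<in> A k \<Longrightarrow> k \<notin> {0..int n} \<Longrightarrow> x = 0"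
  using grading_outside[of k] by auto

lemma component_homogeneous:
  assumes "x \<in> A i"
  shows "component j x = (if j = i then x else 0)"
proof (rule component_unique)
  show "(if k = i then x else 0) \<in> A k" for k
    using assms by simp
  show "x = (\<Sum>k=0..int n. if k = i then x else 0)"
    using degree_outside[OF assms] by (simp add: sum.delta)
qed

lemma lin_component: "lin (component i)"
proof (rule linI)
  show "component i (x + y) = component i x + component i y" for x y
    by (rule component_unique)
      (simp_all add: component_mem subspace_add[OF subspace_grading] sum.distrib sum_component)
  show "component i (c *s x) = c *s component i x" for c x
    by (rule component_unique)
      (simp_all add: component_mem subspace_scale[OF subspace_grading] sum_component
        flip: scale_sum_right)
qed

lemma component_commute:
  assumes "lin f" and degree: "\<And>k x. x \<in> A k \<Longrightarrow> f x \<in> A k"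
  shows "component i (f x) = f (component i x)"
proof (rule component_unique)
  show "f (component k x) \<in> A k" for k
    by (intro degree component_mem)
  show "f x = (\<Sum>k=0..int n. f (component k x))"
    by (simp add: sum_component flip: lin_sum[OF \<open>lin f\<close>])
qed

lemma lin_mult_left: "lin f \<Longrightarrow> lin (\<lambda>x. f x * y)"
  by (rule linI) (simp_all add: lin_add lin_scale scale_mult_left distrib_right)

lemma lin_mult_right: "lin f \<Longrightarrow> lin (\<lambda>x. y * f x)"
  by (rule linI) (simp_all add: lin_add lin_scale scale_mult_right distrib_left)

lemma d_one: "d 1 = 0"
  using Leibniz[OF one_degree, of 1] by simp

end

section \<open>The pairing\<close>

lemma neg_one_powi: "(-1) powi k = (if even k then 1 else -1 :: 'f::field_char_0)"
  by (simp add: power_int_minus_left)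

context poincare_dgca
begin

abbreviation form :: "'b \<Rightarrow> 'b \<Rightarrow> 'a" (\<open>\<langle>_,_\<rangle>\<close>) where
  "\<langle>x,y\<rangle> \<equiv> pairing integral x y"

lemma integral_zero: "integral (coh_class 0) = 0"
  using integral_scale[of 0 0] by simp

lemma integral_exact: "integral (coh_class (d z)) = 0"
proof -
  have "coh_class (d z) = coh_class 0"
  proof -
    have "\<exists>y'. d z + d y = d y'" "\<exists>y'. d y = d z + d y'" for y
      using lin_add[OF linear_d, of z y] lin_diff[OF linear_d, of y z]
      by (metis, metis add_diff_cancel_left' add.commute diff_add_cancel)
    then show ?thesis
      unfolding coh_class_def by auto
  qed
  then show ?thesis
    by (simp add: integral_zero)
qed

lemma component_product_degree: "component i x * component (int n - i) y \<in> A (int n)"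
  using mult_degree[OF component_mem component_mem, of i x "int n - i" y] by simp

lemma functional_form_left: "functional (\<lambda>x. \<langle>x,y\<rangle>)"
  by (rule functionalI)
    (simp_all add: pairing_def lin_add[OF lin_component] lin_scale[OF lin_component]
      distrib_right scale_mult_left integral_add integral_scale component_product_degree
      sum.distrib sum_distrib_left)

lemma functional_form_right: "functional (\<lambda>y. \<langle>x,y\<rangle>)"
  by (rule functionalI)
    (simp_all add: pairing_def lin_add[OF lin_component] lin_scale[OF lin_component]
      distrib_left scale_mult_right integral_add integral_scale component_product_degree
      sum.distrib sum_distrib_left)

lemma form_homogeneous:
  assumes "x \<in> A i" "y \<in> A j"
  shows "\<langle>x,y\<rangle> = (if i + j = int n then integral (coh_class (x * y)) else 0)"
proof -
  have "\<langle>x,y\<rangle> = (\<Sum>k=0..int n. if k = i then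
      (if i + j = int n then integral (coh_class (x * y)) else 0) else 0)"
    unfolding pairing_def
    by (intro sum.cong refl)
      (use assms in \<open>auto simp: component_homogeneous integral_zero\<close>)
  also have "\<dots> = (if i + j = int n then integral (coh_class (x * y)) else 0)"
    using degree_outside[OF assms(1)] integral_zero by (auto simp: sum.delta)
  finally show ?thesis .
qed

lemma form_commute:
  assumes "x \<in> A i" "y \<in> A j"
  shows "\<langle>x,y\<rangle> = (-1) powi (i * j) * \<langle>y,x\<rangle>"
proof (cases "i + j = int n")
  case True
  then have "y * x \<in> A (int n)"
    using mult_degree[OF assms(2,1)] by (simp add: add.commute)
  then show ?thesis
    using True graded_commutative[OF assms(2,1)]
    by (simp add: form_homogeneous[OF assms] form_homogeneous[OF assms(2,1)] integral_scale
        mult.commute add.commute)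
next
  case False
  then show ?thesis
    by (simp add: form_homogeneous[OF assms] form_homogeneous[OF assms(2,1)] add.commute)
qed

lemma form_assoc:
  assumes "x \<in> A i" "y \<in> A j" "z \<in> A k"
  shows "\<langle>x * y,z\<rangle> = \<langle>x,y * z\<rangle>"
  using assms by (simp add: form_homogeneous[where i = "i + j" and j = k]
      form_homogeneous[where i = i and j = "j + k"] mult_degree mult.assoc add.assoc)

text \<open>Stokes' theorem: the integral of the exact element \<open>d (x * y)\<close> vanishes.\<close>

lemma form_d:
  assumes "x \<in> A i" "y \<in> A j"
  shows "\<langle>d x,y\<rangle> = - ((-1) powi i) * \<langle>x,d y\<rangle>"
proof (cases "i + j + 1 = int n")
  case True
  have degrees: "d x * y \<in> A (int n)" "x * d y \<in> A (int n)"
    using mult_degree[OF d_degree[OF assms(1)] assms(2)]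
      mult_degree[OF assms(1) d_degree[OF assms(2)]] True
    by (simp_all add: algebra_simps)
  have "0 = integral (coh_class (d (x * y)))"
    by (simp add: integral_exact)
  also have "\<dots> = integral (coh_class (d x * y)) + (-1) powi i * integral (coh_class (x * d y))"
    using degrees subspace_scale[OF subspace_grading]
    by (simp add: Leibniz[OF assms(1)] integral_add integral_scale)
  finally show ?thesis
    using True
    by (simp add: form_homogeneous[OF d_degree[OF assms(1)] assms(2)] eq_neg_iff_add_eq_0
        form_homogeneous[OF assms(1) d_degree[OF assms(2)]] algebra_simps)
next
  case False
  then show ?thesis
    by (simp add: form_homogeneous[OF d_degree[OF assms(1)] assms(2)]
        form_homogeneous[OF assms(1) d_degree[OF assms(2)]] algebra_simps)
qed

end

section \<open>The harmonic projection\<close>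

context hodge_homotopy
begin

abbreviation proj :: "'b \<Rightarrow> 'b" (\<open>\<pi>\<close>) where
  "\<pi> \<equiv> harmonic_proj h"

lemma lin_proj: "lin \<pi>"
  unfolding harmonic_proj_def
  by (rule linI)
    (simp_all add: lin_add[OF linear_h] lin_add[OF linear_d] lin_scale[OF linear_h]
      lin_scale[OF linear_d] scale_right_diff_distrib)

lemma h_proj: "h (\<pi> x) = 0"
  by (simp add: harmonic_proj_def lin_diff[OF linear_h] h_square h_d_h)

lemma d_proj: "d (\<pi> x) = 0"
  by (simp add: harmonic_proj_def lin_diff[OF linear_d] d_square d_h_d)

lemma proj_h: "\<pi> (h x) = 0"
  by (simp add: harmonic_proj_def h_square h_d_h lin_zero[OF linear_d])

lemma proj_degree: "x \<in> A k \<Longrightarrow> \<pi> x \<in> A k"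
  unfolding harmonic_proj_def
  using d_degree[OF h_degree, of x k] h_degree[OF d_degree, of x k]
  by (simp add: subspace_diff[OF subspace_grading])

lemma harmonic_iff: "x \<in> harmonic h \<longleftrightarrow> h x = 0 \<and> d x = 0"
proof
  assume "h x = 0 \<and> d x = 0"
  then have "x = \<pi> x"
    by (simp add: harmonic_proj_def lin_zero[OF linear_h] lin_zero[OF linear_d])
  then show "x \<in> harmonic h"
    unfolding harmonic_def by (rule range_eqI)
qed (auto simp: harmonic_def h_proj d_proj)

lemma proj_harmonic: "x \<in> harmonic h \<Longrightarrow> \<pi> x = x"
  by (simp add: harmonic_iff harmonic_proj_def lin_zero[OF linear_h] lin_zero[OF linear_d])

lemma subspace_harmonic: "subspace (harmonic h)"
  by (rule subspaceI)
    (simp_all add: harmonic_iff lin_zero[OF linear_h] lin_zero[OF linear_d]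
      lin_add[OF linear_h] lin_add[OF linear_d] lin_scale[OF linear_h] lin_scale[OF linear_d])

lemma component_harmonic:
  assumes "x \<in> harmonic h"
  shows "component i x \<in> harmonic h"
proof -
  have "component i x = \<pi> (component i x)"
    using component_commute[OF lin_proj proj_degree, of i x] proj_harmonic[OF assms] by simp
  then show ?thesis
    unfolding harmonic_def by (rule range_eqI)
qed

text \<open>The homotopy lowers the degree, so it kills \<open>A 0\<close>, which contains the unit.\<close>

lemma one_harmonic: "1 \<in> harmonic h"
  using h_degree[OF one_degree] degree_outside[of "h 1" "-1"]
  by (simp add: harmonic_iff d_one)

lemma form_h_proj:
  assumes "x \<in> A i" "y \<in> A j"
  shows "\<langle>h x, \<pi> y\<rangle> = 0"
  using form_commute[OF h_degree[OF assms(1)] proj_degree[OF assms(2)]]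
  by (simp add: harmonic_h_orthogonal)

text \<open>
  Both sides equal \<open>\<langle>d (h x), h y\<rangle>\<close>: by orthogonality only the exact part of
  \<open>x = \<pi> x + d (h x) + h (d x)\<close> pairs with \<open>h y\<close>, only \<open>d (h y)\<close> pairs with \<open>h x\<close>, and Stokes'
  theorem moves \<open>d\<close> across the pairing.
\<close>

lemma form_h_adjoint:
  assumes "x \<in> A i" "y \<in> A j"
  shows "\<langle>x, h y\<rangle> = (-1) powi i * \<langle>h x, y\<rangle>"
proof -
  have decompose: "z = \<pi> z + d (h z) + h (d z)" for z
    by (simp add: harmonic_proj_def)
  have "\<langle>x, h y\<rangle> = \<langle>\<pi> x + d (h x) + h (d x), h y\<rangle>"
    using decompose[of x] by simp
  also have "\<dots> = \<langle>d (h x), h y\<rangle>"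
    by (simp add: functional_add[OF functional_form_left] harmonic_h_orthogonal h_h_orthogonal)
  also have "\<dots> = (-1) powi i * \<langle>h x, d (h y)\<rangle>"
    using form_d[OF h_degree[OF assms(1)] h_degree[OF assms(2)]]
    by (simp add: neg_one_powi)
  also have "\<langle>h x, d (h y)\<rangle> = \<langle>h x, \<pi> y + d (h y) + h (d y)\<rangle>"
    by (simp add: functional_add[OF functional_form_right] form_h_proj[OF assms] h_h_orthogonal)
  also have "\<dots> = \<langle>h x, y\<rangle>"
    using decompose[of y] by simp
  finally show ?thesis .
qed

text \<open>
  An exact element pairs to zero with the cocycle \<open>y\<close>, and a value of \<open>h\<close> is orthogonal to the
  harmonic subspace.
\<close>

lemma form_proj_harmonic:
  assumes "x \<in> A i" "y \<in> A j" "y \<in> harmonic h"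
  shows "\<langle>\<pi> x, y\<rangle> = \<langle>x, y\<rangle>"
proof -
  have "\<langle>d (h x), y\<rangle> = 0"
    using form_d[OF h_degree[OF assms(1)] assms(2)] assms(3)
    by (simp add: harmonic_iff functional_zero[OF functional_form_right])
  moreover have "\<langle>h (d x), y\<rangle> = 0"
    using form_h_proj[OF d_degree[OF assms(1)] assms(2)] proj_harmonic[OF assms(3)] by simp
  ultimately show ?thesis
    by (simp add: harmonic_proj_def functional_diff[OF functional_form_left])
qed

section \<open>The recursion as a sum over splittings\<close>

text \<open>
  The value carried by an edge of a tree: a leaf contributes its label, an inner edge applies \<open>h\<close>.
  The sign on leaves is the one that lets the terms of the recursion with a leaf factor obey the same
  sign rule as the others.
\<close>

definition propagate :: "(int \<times> 'b) list \<Rightarrow> 'b" where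
  "propagate xs = (if length xs = 1 then - snd (hd xs) else h (mhat h xs))"

abbreviation deg :: "(int \<times> 'b) list \<Rightarrow> int" where
  "deg xs \<equiv> sum_list (map fst xs)"

text \<open>
  The first and the last summand are the two terms with a leaf factor; for two arguments they coincide
  and the signs of the leaves cancel. On shorter lists the empty sum agrees with the
  convention that \<open>mhat\<close> vanishes there; row \<open>k\<close> and column \<open>1\<close> of the double count in
  \<open>mhat_cyclic\<close> rely on this.
\<close>

lemma mhat_splittings:
  "mhat h xs = - (\<Sum>i=1..<length xs.
     (-1) powi (int i + (int (length xs) - int i - 1) * deg (take i xs)) *s
       (propagate (take i xs) * propagate (drop i xs)))"
proof -
  define k where "k = length xs"
  define T where "T i = (-1) powi (int i + (int k - int i - 1) * deg (take i xs)) *s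
       (propagate (take i xs) * propagate (drop i xs))" for i
  have "mhat h xs = - (\<Sum>i=1..<k. T i)"
  proof -
    consider "k < 2" | "k = 2" | "k \<ge> 3"
      by linarith
    then show ?thesis
    proof cases
      case 1
      then show ?thesis
        by (subst mhat.simps) (auto simp: k_def)
    next
      case 2
      then obtain a b where xs: "xs = [a, b]"
        unfolding k_def by (metis length_0_conv length_Suc_conv numeral_2_eq_2)
      have "{1..<k} = {1}"
        using 2 by auto
      then show ?thesis
        using 2 by (subst mhat.simps) (simp add: xs T_def propagate_def)
    next
      case 3
      then obtain a ys where xs: "xs = a # ys" "ys \<noteq> []"
        unfolding k_def by (cases xs) fastforce+
      have "k - 1 = Suc (k - 2)" "1 \<le> k - 2"
        using 3 by simp_all
      then have "{1..<k} = insert 1 (insert (k - 1) {2..k - 2})"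
        using 3 by auto
      then have "(\<Sum>i=1..<k. T i) = T 1 + T (k - 1) + (\<Sum>i=2..k - 2. T i)"
      proof -
        have "1 \<notin> insert (k - 1) {2..k - 2}" "k - 1 \<notin> {2..k - 2}"
          using 3 by auto
        then show ?thesis
          unfolding \<open>{1..<k} = _\<close> by (simp add: add.assoc)
      qed
      moreover have "T 1 = (-1) powi (int k * fst (hd xs)) *s
          (snd (hd xs) * h (mhat h (drop 1 xs)))"
        using 3 xs
        by (auto simp: T_def propagate_def k_def neg_one_powi algebra_simps even_mult_iff)
      moreover have "T (k - 1) = - ((-1) ^ (k - 1) *s (h (mhat h (take (k - 1) xs)) * snd (last xs)))"
      proof -
        have "drop (k - 1) xs = [last xs]"
          using append_eq_conv_conj[of "butlast xs" "[last xs]" xs] xs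
          by (simp add: k_def del: length_Cons drop_Suc_Cons)
        moreover have "length (take (k - 1) xs) \<noteq> 1"
          using 3 by (simp add: k_def)
        ultimately show ?thesis
          using 3 by (simp add: T_def propagate_def neg_one_powi minus_one_power_iff del: length_take)
      qed
      moreover have "(\<Sum>i=2..k - 2. T i) = (\<Sum>i=2..k - 2.
           ((-1) powi (int i + (int k - int i - 1) * deg (take i xs))) *s
             (h (mhat h (take i xs)) * h (mhat h (drop i xs))))"
        by (rule sum.cong) (auto simp: T_def propagate_def k_def)
      ultimately show ?thesis
        using 3 by (subst mhat.simps) (simp add: k_def)
    qed
  qed
  then show ?thesis
    by (simp only: T_def k_def)
qed

lemma propagate_singleton: "propagate [a] = - snd a"
  by (simp add: propagate_def)

text \<open>
  The degrees recorded in the list are kept fixed while the entry varies; they determine the signs, so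
  linearity holds for arbitrary entries.
\<close>

lemma lin_mhat_slot: "lin (\<lambda>x. mhat h (us @ [(i, x)] @ vs))"
proof (induction "length us + length vs" arbitrary: us vs rule: less_induct)
  case less
  have propagate: "lin (\<lambda>x. propagate (us' @ [(i, x)] @ vs'))"
    if "length us' + length vs' < length us + length vs" for us' vs'
  proof (cases "us' = [] \<and> vs' = []")
    case True
    then show ?thesis
      by (simp add: propagate_def linI)
  next
    case False
    then show ?thesis
      using lin_compose[OF linear_h less[OF that]] by (auto simp: propagate_def)
  qed
  have "lin (\<lambda>x. propagate (take j (us @ [(i, x)] @ vs)) * propagate (drop j (us @ [(i, x)] @ vs)))"
    if j: "j \<in> {1..<length us + length vs + 1}" for j
  proof (cases "j \<le> length us")
    case True
    then show ?thesis
      using propagate[of "drop j us" vs] j by (simp add: lin_mult_right)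
  next
    case False
    then obtain l where l: "j - length us = Suc l"
      using not_less_eq_eq by (metis Suc_diff_le diff_Suc_Suc)
    moreover have "l < length vs"
      using l j unfolding atLeastLessThan_iff by arith
    ultimately show ?thesis
      using propagate[of us "take l vs"] by (simp add: lin_mult_left)
  qed
  moreover have "deg (take j (us @ [(i, x)] @ vs)) =
      sum_list (take j (map fst us @ [i] @ map fst vs))" for j x
    by (simp flip: take_map)
  moreover have "length (us @ [(i, x)] @ vs) = length us + length vs + 1" for x :: 'b
    by simp
  ultimately show ?case
    unfolding mhat_splittings[of "us @ [(i, _)] @ vs"]
    by (simp only:) (intro lin_minus lin_sum_fun lin_scaled, blast)
qed

lemma mhat_zero_slot: "(i, 0) \<in> set xs \<Longrightarrow> mhat h xs = 0"
  using lin_zero[OF lin_mhat_slot] by (metis append_Cons append_Nil split_list)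

abbreviation homogeneous :: "(int \<times> 'b) list \<Rightarrow> bool" where
  "homogeneous xs \<equiv> \<forall>(i, x)\<in>set xs. x \<in> A i"

lemma
  assumes "homogeneous xs" "xs \<noteq> []"
  shows mhat_degree: "mhat h xs \<in> A (deg xs + 2 - int (length xs))"
    and propagate_degree: "propagate xs \<in> A (deg xs + 1 - int (length xs))"
proof -
  have "mhat h xs \<in> A (deg xs + 2 - int (length xs)) \<and>
      propagate xs \<in> A (deg xs + 1 - int (length xs))"
    using assms
  proof (induction "length xs" arbitrary: xs rule: less_induct)
    case less
    have "propagate (take i xs) * propagate (drop i xs) \<in> A (deg xs + 2 - int (length xs))"
      if "i \<in> {1..<length xs}" for i
    proof -
      have "homogeneous (take i xs)" "homogeneous (drop i xs)"
        using less.prems by (meson in_set_takeD in_set_dropD)+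
      then have "propagate (take i xs) \<in> A (deg (take i xs) + 1 - int (length (take i xs)))"
        "propagate (drop i xs) \<in> A (deg (drop i xs) + 1 - int (length (drop i xs)))"
        using less.hyps[of "take i xs"] less.hyps[of "drop i xs"] that less.prems(2)
        by (simp_all add: Suc_le_eq)
      moreover have "deg xs = deg (take i xs) + deg (drop i xs)"
        by (metis append_take_drop_id map_append sum_list_append)
      ultimately show ?thesis
        using mult_degree[of "propagate (take i xs)" _ "propagate (drop i xs)"] that
        by (fastforce simp: algebra_simps)
    qed
    then have mhat: "mhat h xs \<in> A (deg xs + 2 - int (length xs))"
      by (subst mhat_splittings)
        (intro subspace_neg subspace_sum subspace_scale subspace_grading; simp)
    moreover have "propagate xs \<in> A (deg xs + 1 - int (length xs))"
    proof (cases "length xs = 1")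
      case True
      then show ?thesis
        using less.prems subspace_neg[OF subspace_grading]
        by (auto simp: propagate_def length_Suc_conv)
    next
      case False
      then show ?thesis
        using h_degree[OF mhat] by (simp add: propagate_def algebra_simps)
    qed
    ultimately show ?case ..
  qed
  then show "mhat h xs \<in> A (deg xs + 2 - int (length xs))"
    "propagate xs \<in> A (deg xs + 1 - int (length xs))" by auto
qed

section \<open>The transferred operations\<close>

lemma transferred_sum:
  "transferred h xs = (\<Sum>ds | length ds = length xs \<and> set ds \<subseteq> {0..int n}.
     \<pi> (mhat h (map2 (\<lambda>i x. (i, component i x)) ds xs)))"
  by (simp add: transferred_def lin_sum[OF lin_proj])

lemma lin_transferred_slot: "lin (\<lambda>x. transferred h (us @ [x] @ vs))"
proof -
  have "lin (\<lambda>x. \<pi> (mhat h (map2 (\<lambda>i x. (i, component i x)) ds (us @ [x] @ vs))))"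
    if "length ds = length us + length vs + 1" for ds
  proof -
    have ds: "ds = take (length us) ds @ [ds ! length us] @ drop (Suc (length us)) ds"
      using that by (simp add: id_take_nth_drop)
    have "lin (\<lambda>x. \<pi> (mhat h (map2 (\<lambda>i x. (i, component i x)) (take (length us) ds) us @
        [(ds ! length us, component (ds ! length us) x)] @
        map2 (\<lambda>i x. (i, component i x)) (drop (Suc (length us)) ds) vs)))"
      by (intro lin_compose[OF lin_proj] lin_compose[OF lin_mhat_slot lin_component])
    then show ?thesis
      using that by (subst ds) simp
  qed
  moreover have "length (us @ [x] @ vs) = length us + length vs + 1" for x :: 'b
    by simp
  ultimately show ?thesis
    unfolding transferred_sum by (simp only:) (intro lin_sum_fun, blast)
qed

text \<open>
  In the sum over degree lists every list other than \<open>ds\<close> puts a zero component in some slot. If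
  \<open>ds\<close> leaves the range of degrees, then some argument is itself zero and both sides vanish.
\<close>

lemma transferred_homogeneous:
  assumes "list_all2 (\<lambda>x i. x \<in> A i) xs ds"
  shows "transferred h xs = \<pi> (mhat h (zip ds xs))"
proof -
  let ?S = "{es. length es = length xs \<and> set es \<subseteq> {0..int n}}"
  let ?f = "\<lambda>es. \<pi> (mhat h (map2 (\<lambda>i x. (i, component i x)) es xs))"
  have len: "length ds = length xs" and mem: "\<And>j. j < length xs \<Longrightarrow> xs ! j \<in> A (ds ! j)"
    using assms by (auto simp: list_all2_conv_all_nth)
  have "finite ?S"
    using finite_lists_length_eq[of "{0..int n}" "length xs"] by (simp add: conj_commute)
  moreover have "?f es = (if es = ds then \<pi> (mhat h (zip ds xs)) else 0)" if es: "es \<in> ?S" for es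
  proof (cases "es = ds")
    case True
    have "map2 (\<lambda>i x. (i, component i x)) ds xs = zip ds xs"
      using len mem by (intro nth_equalityI) (simp_all add: component_homogeneous[OF mem])
    then show ?thesis
      using True by simp
  next
    case False
    then obtain j where j: "j < length xs" "es ! j \<noteq> ds ! j"
      using es len by (auto simp: list_eq_iff_nth_eq)
    have "(es ! j, 0) \<in> set (map2 (\<lambda>i x. (i, component i x)) es xs)"
      using j es mem[OF j(1)] by (force simp: in_set_conv_nth component_homogeneous)
    then show ?thesis
      using False by (simp add: mhat_zero_slot lin_zero[OF lin_proj])
  qed
  then have "transferred h xs = (\<Sum>es\<in>?S. if es = ds then \<pi> (mhat h (zip ds xs)) else 0)"
    unfolding transferred_sum by (rule sum.cong[OF refl])
  ultimately have "transferred h xs = (if ds \<in> ?S then \<pi> (mhat h (zip ds xs)) else 0)"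
    by (simp only: sum.delta)
  moreover have "mhat h (zip ds xs) = 0" if ds: "ds \<notin> ?S"
  proof -
    obtain j where j: "j < length xs" "ds ! j \<notin> {0..int n}"
      using ds len by (auto simp: subset_eq in_set_conv_nth)
    then have "xs ! j = 0"
      using degree_outside mem by blast
    then have "(ds ! j, 0) \<in> set (zip ds xs)"
      using j len by (force simp: in_set_conv_nth)
    then show ?thesis
      by (rule mhat_zero_slot)
  qed
  ultimately show ?thesis
    by (auto simp: lin_zero[OF lin_proj])
qed

lemma transferred_minimal: "minimal_operations (harmonic h) (transferred h)"
  unfolding minimal_operations_def
proof (intro conjI allI impI ballI)
  show "subspace (harmonic h)"
    by (rule subspace_harmonic)
  show "transferred h xs \<in> harmonic h" for xs
    by (simp add: transferred_def harmonic_def)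
  show "transferred h [x] = 0" for x
  proof -
    have "mhat h ys = 0" if "length ys = 1" for ys
      using that by (simp add: mhat_splittings[of ys])
    then show ?thesis
      by (simp add: transferred_sum lin_zero[OF lin_proj])
  qed
  show "transferred h (us @ [x + y] @ vs) = transferred h (us @ [x] @ vs) + transferred h (us @ [y] @ vs)"
    "transferred h (us @ [c *s x] @ vs) = c *s transferred h (us @ [x] @ vs)" for us vs x y c
    by (fact lin_add[OF lin_transferred_slot] lin_scale[OF lin_transferred_slot])+
  fix xs ds
  assume xs: "xs \<noteq> [] \<and> list_all2 (\<lambda>x i. x \<in> harmonic h \<inter> A i) xs ds"
  then have homogeneous: "list_all2 (\<lambda>x i. x \<in> A i) xs ds"
    by (auto elim: list_all2_mono)
  then have len: "length xs = length ds"
    by (rule list_all2_lengthD)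
  have "homogeneous (zip ds xs)"
    using homogeneous by (auto simp: list_all2_conv_all_nth in_set_zip)
  moreover have "zip ds xs \<noteq> []"
    using xs len by (cases xs; cases ds) auto
  ultimately show "transferred h xs \<in> A (sum_list ds + 2 - int (length xs))"
    using mhat_degree[of "zip ds xs"] len
    by (simp add: transferred_homogeneous[OF homogeneous] proj_degree)
qed

section \<open>Strict unitality\<close>

text \<open>
  The two claims support each other. If the unit lies in a piece of length at least two, then
  \<open>propagate\<close> vanishes on that piece by induction; otherwise the unit is a piece of its own, and the
  summand is up to sign the other factor, a value of \<open>h\<close>. Hence \<open>mhat\<close> lies in the range of \<open>h\<close>, and
  \<open>h\<close> vanishes there. For two arguments \<open>mhat\<close> is the other argument, which is harmonic.
\<close>

lemma
  assumes "snd ` set xs \<subseteq> harmonic h" "1 \<in> snd ` set xs"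
  shows propagate_unit: "length xs \<ge> 2 \<Longrightarrow> propagate xs = 0"
    and mhat_unit: "length xs \<ge> 3 \<Longrightarrow> mhat h xs \<in> range h"
proof -
  have "(length xs \<ge> 2 \<longrightarrow> propagate xs = 0) \<and> (length xs \<ge> 3 \<longrightarrow> mhat h xs \<in> range h)"
    using assms
  proof (induction "length xs" arbitrary: xs rule: less_induct)
    case less
    have range: "mhat h xs \<in> range h" if "length xs \<ge> 3"
    proof -
      have subspace: "subspace (range h)"
        by (rule subspaceI)
          (auto simp flip: lin_add[OF linear_h] lin_scale[OF linear_h]
            intro: range_eqI[of _ _ 0] simp: lin_zero[OF linear_h])
      have "propagate (take i xs) * propagate (drop i xs) \<in> range h" if i: "i \<in> {1..<length xs}" for i
      proof -
        have harmonic: "snd ` set (take i xs) \<subseteq> harmonic h" "snd ` set (drop i xs) \<subseteq> harmonic h"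
          using less.prems(1) by (meson image_mono set_take_subset set_drop_subset subset_trans)+
        have "set xs = set (take i xs) \<union> set (drop i xs)"
          by (metis append_take_drop_id set_append)
        then consider "1 \<in> snd ` set (take i xs)" | "1 \<in> snd ` set (drop i xs)"
          using less.prems(2) by auto
        then show ?thesis
        proof cases
          case 1
          show ?thesis
          proof (cases "i = 1")
            case True
            then have "propagate (take i xs) = - 1"
              using 1 i by (cases xs) (auto simp: propagate_def)
            moreover have "propagate (drop i xs) = h (mhat h (drop i xs))"
              using True \<open>length xs \<ge> 3\<close> by (auto simp: propagate_def)
            ultimately show ?thesis
              using subspace_neg[OF subspace] by simp
          next
            case False
            then have "propagate (take i xs) = 0"
              using less.hyps[of "take i xs"] harmonic 1 i by auto
            then show ?thesis
              using subspace_0[OF subspace] by simp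
          qed
        next
          case 2
          show ?thesis
          proof (cases "length (drop i xs) = 1")
            case True
            then have "propagate (drop i xs) = - 1"
              using 2 by (auto simp: propagate_def length_Suc_conv simp del: length_drop)
            moreover have "length (take i xs) \<noteq> 1"
              using True i \<open>length xs \<ge> 3\<close> by auto
            then have "propagate (take i xs) = h (mhat h (take i xs))"
              by (simp only: propagate_def if_False)
            ultimately show ?thesis
              using subspace_neg[OF subspace] by simp
          next
            case False
            then have "propagate (drop i xs) = 0"
              using less.hyps[of "drop i xs"] harmonic 2 i by auto
            then show ?thesis
              using subspace_0[OF subspace] by simp
          qed
        qed
      qed
      then show ?thesis
        by (subst mhat_splittings) (intro subspace_neg subspace_sum subspace_scale subspace; simp)
    qed
    have "propagate xs = 0" if "length xs \<ge> 2"
    proof (cases "length xs = 2")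
      case True
      then obtain a b where xs: "xs = [a, b]"
        by (metis length_0_conv length_Suc_conv numeral_2_eq_2)
      then have "mhat h xs = snd a * snd b"
        by (subst mhat.simps) simp
      then have "mhat h xs \<in> harmonic h"
        using less.prems xs by auto
      then show ?thesis
        using True by (simp add: propagate_def harmonic_iff)
    next
      case False
      then show ?thesis
        using range that by (auto simp: propagate_def h_square)
    qed
    then show ?case
      using range by blast
  qed
  then show "length xs \<ge> 2 \<Longrightarrow> propagate xs = 0" "length xs \<ge> 3 \<Longrightarrow> mhat h xs \<in> range h"
    by blast+
qed

lemma transferred_unital: "strictly_unital (harmonic h) (transferred h)"
  unfolding strictly_unital_def
proof (intro conjI ballI allI impI)
  show "1 \<in> harmonic h"
    by (rule one_harmonic)
next
  \<comment> \<open>\<open>transferred\<close> reduces to a single value of \<open>mhat\<close> only on homogeneous arguments, so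
    \<open>x\<close> is split into its components.\<close>
  fix x assume x: "x \<in> harmonic h"
  have pair: "mhat h [a, b] = snd a * snd b" for a b
    by (subst mhat.simps) simp
  have homogeneous: "transferred h [1, component k x] = component k x"
    "transferred h [component k x, 1] = component k x" for k
    using transferred_homogeneous[of "[1, component k x]" "[0, k]"]
      transferred_homogeneous[of "[component k x, 1]" "[k, 0]"]
      proj_harmonic[OF component_harmonic[OF x]]
    by (simp_all add: component_mem one_degree pair)
  have "transferred h [1, x] = transferred h [1, \<Sum>k=0..int n. component k x]"
    by (simp add: sum_component)
  also have "\<dots> = (\<Sum>k=0..int n. transferred h [1, component k x])"
    using lin_sum[OF lin_transferred_slot[of "[1]" "[]"]] by (simp only: append_Cons append_Nil)
  also have "\<dots> = x"
    by (simp only: homogeneous sum_component)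
  finally show "transferred h [1, x] = x" .
  have "transferred h [x, 1] = transferred h [\<Sum>k=0..int n. component k x, 1]"
    by (simp add: sum_component)
  also have "\<dots> = (\<Sum>k=0..int n. transferred h [component k x, 1])"
    using lin_sum[OF lin_transferred_slot[of "[]" "[1]"]] by (simp only: append_Cons append_Nil)
  also have "\<dots> = x"
    by (simp only: homogeneous sum_component)
  finally show "transferred h [x, 1] = x" .
next
  fix xs assume xs: "3 \<le> length xs \<and> set xs \<subseteq> harmonic h \<and> 1 \<in> set xs"
  then obtain j where j: "j < length xs" "xs ! j = 1"
    by (auto simp: in_set_conv_nth)
  have "\<pi> (mhat h (map2 (\<lambda>i x. (i, component i x)) ds xs)) = 0" (is "\<pi> (mhat h ?ys) = 0")
    if len: "length ds = length xs" for ds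
  proof -
    have entry: "(ds ! j, component (ds ! j) 1) \<in> set ?ys"
      using j len by (force simp: in_set_conv_nth)
    show ?thesis
    proof (cases "ds ! j = 0")
      case True
      then have "1 \<in> snd ` set ?ys"
        using entry by (force simp: component_homogeneous[OF one_degree])
      moreover have "snd ` set ?ys \<subseteq> harmonic h"
        using xs by (auto dest!: set_zip_rightD intro!: component_harmonic)
      ultimately show ?thesis
        using mhat_unit[of ?ys] xs len by (auto simp: proj_h)
    next
      case False
      then show ?thesis
        using entry mhat_zero_slot[of "ds ! j" ?ys]
        by (simp add: component_homogeneous[OF one_degree] lin_zero[OF lin_proj])
    qed
  qed
  then show "transferred h xs = 0"
    by (simp add: transferred_sum)
qed

section \<open>Cyclicity\<close>

lemma form_mhat_propagate:
  "\<langle>mhat h xs, y\<rangle> = - (\<Sum>i=1..<length xs.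
     (-1) powi (int i + (int (length xs) - int i - 1) * deg (take i xs)) *
       \<langle>propagate (take i xs) * propagate (drop i xs), y\<rangle>)"
  by (subst mhat_splittings)
    (simp add: functional_neg[OF functional_form_left] functional_sum[OF functional_form_left]
      functional_scale[OF functional_form_left])

lemma form_propagate_mhat:
  "\<langle>y, mhat h xs\<rangle> = - (\<Sum>i=1..<length xs.
     (-1) powi (int i + (int (length xs) - int i - 1) * deg (take i xs)) *
       \<langle>y, propagate (take i xs) * propagate (drop i xs)\<rangle>)"
  by (subst mhat_splittings)
    (simp add: functional_neg[OF functional_form_right] functional_sum[OF functional_form_right]
      functional_scale[OF functional_form_right])

text \<open>
  Double counting of the triple products \<open>V i j\<close> by rows and by columns: \<open>C j\<close> is the sum of column
  \<open>j\<close> and \<open>R i\<close> that of row \<open>i\<close>, both with signs. The claim compares column \<open>k\<close> with row \<open>1\<close>.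
\<close>

lemma mhat_cyclic:
  assumes hom: "homogeneous xs" and len: "length xs = k + 1" and "k \<ge> 2"
  shows "(-1) ^ k * \<langle>mhat h (take k xs), propagate (drop k xs)\<rangle> =
    (-1) powi (int k * deg (take 1 xs)) * \<langle>propagate (take 1 xs), mhat h (drop 1 xs)\<rangle>"
proof -
  define D where "D j = deg (take j xs)" for j
  define V where "V i j = \<langle>propagate (take i xs),
    propagate (take (j - i) (drop i xs)) * propagate (drop j xs)\<rangle>" for i j
  define C where "C j = \<langle>mhat h (take j xs), propagate (drop j xs)\<rangle>" for j
  define R where "R i = \<langle>propagate (take i xs), mhat h (drop i xs)\<rangle>" for i
  \<comment> \<open>The recursion gives \<open>V i j\<close> different signs in \<open>C j\<close> and in \<open>R i\<close>. The exponents \<open>w\<close>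
    and \<open>u\<close> solve the parity condition that the signs agree after weighting, for all \<open>i < j\<close>; they
    moreover differ in parity by \<open>D m + m\<close>, the exponent of the sign of the adjunction of \<open>h\<close>.\<close>
  define w where "w j = int j + (int k + int j) * D j" for j
  define u where "u i = (int k + int i + 1) * D i" for i
  define W where "W i j = (-1) powi (w j + int i + (int j - int i - 1) * D i) * V i j" for i j
  have hom_take: "homogeneous (take i xs)" and hom_drop: "homogeneous (drop i xs)" for i
    using hom by (meson in_set_takeD in_set_dropD)+
  have column: "(-1) powi w j * C j = - (\<Sum>i | i \<in> {1..k} \<and> i < j. W i j)"
    if j: "j \<in> {1..k}" for j
  proof -
    have "\<langle>propagate (take i (take j xs)) * propagate (drop i (take j xs)), propagate (drop j xs)\<rangle> = V i j"
      if "i \<in> {1..<j}" for i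
    proof -
      have "homogeneous (take (j - i) (drop i xs))"
        using hom_drop[of i] by (meson in_set_takeD)
      moreover have "take i xs \<noteq> []" "take (j - i) (drop i xs) \<noteq> []" "drop j xs \<noteq> []"
        "take i (take j xs) = take i xs"
        using that j len by auto
      moreover have "\<langle>propagate (take i xs) * propagate (take (j - i) (drop i xs)), propagate (drop j xs)\<rangle> = V i j"
        unfolding V_def by (rule form_assoc[OF propagate_degree propagate_degree propagate_degree]) fact+
      ultimately show ?thesis
        by (simp only: drop_take)
    qed
    moreover have "deg (take i (take j xs)) = D i" if "i \<in> {1..<j}" for i
      using that by (simp add: D_def min_def)
    moreover have "length (take j xs) = j"
      using j len by simp
    ultimately have "C j = - (\<Sum>i=1..<j. (-1) powi (int i + (int j - int i - 1) * D i) * V i j)"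
      unfolding C_def form_mhat_propagate
      by (intro arg_cong[where f = uminus] sum.cong) (simp_all only:)
    moreover have "{i. i \<in> {1..k} \<and> i < j} = {1..<j}"
      using j by auto
    ultimately show ?thesis
      by (simp add: W_def sum_distrib_left power_int_add mult.assoc add.assoc)
  qed
  have row: "(-1) powi u i * R i = - (\<Sum>j | j \<in> {1..k} \<and> i < j. W i j)"
    if i: "i \<in> {1..k}" for i
  proof -
    have "R i = - (\<Sum>l=1..<k + 1 - i. (-1) powi (int l + (int (k + 1 - i) - int l - 1) *
        deg (take l (drop i xs))) * V i (i + l))"
      unfolding R_def form_propagate_mhat V_def using len
      by (simp add: add.commute)
    also have "\<dots> = - (\<Sum>j | j \<in> {1..k} \<and> i < j. (-1) powi (int (j - i) + (int k - int j) *
        deg (take (j - i) (drop i xs))) * V i j)"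
      by (intro arg_cong[where f = uminus]
          sum.reindex_bij_witness[where i = "\<lambda>j. j - i" and j = "\<lambda>l. i + l"])
        (use i in \<open>auto simp: of_nat_diff algebra_simps\<close>)
    finally have R: "R i = - (\<Sum>j | j \<in> {1..k} \<and> i < j. (-1) powi (int (j - i) + (int k - int j) *
        deg (take (j - i) (drop i xs))) * V i j)" .
    have "(-1) powi u i * ((-1) powi (int (j - i) + (int k - int j) *
        deg (take (j - i) (drop i xs))) * V i j) = W i j" if j: "j \<in> {1..k} \<and> i < j" for j
    proof -
      have "take j xs = take i xs @ take (j - i) (drop i xs)"
        using j by (metis le_add_diff_inverse less_imp_le take_add)
      then have "D j = D i + deg (take (j - i) (drop i xs))"
        by (simp add: D_def)
      then have "deg (take (j - i) (drop i xs)) = D j - D i"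
        by simp
      then show ?thesis
        using j unfolding W_def w_def u_def
        by (simp add: neg_one_powi of_nat_diff) argo
    qed
    then show ?thesis
      unfolding R mult_minus_right sum_distrib_left
      by (intro arg_cong[where f = uminus] sum.cong refl) blast
  qed
  have inner: "(-1) powi w m * C m = (-1) powi u m * R m" if m: "m \<in> {2..<k}" for m
  proof -
    have "C m = (-1) powi (D m + 2 - int m) * R m"
    proof -
      have "take m xs \<noteq> []" "drop m xs \<noteq> []" "length (take m xs) = m" "length (drop m xs) \<noteq> 1"
        using m len by auto
      then show ?thesis
        using m form_h_adjoint[OF mhat_degree[OF hom_take] mhat_degree[OF hom_drop], of m m]
        by (simp add: C_def R_def propagate_def D_def del: length_take length_drop)
    qed
    then show ?thesis
      by (simp add: w_def u_def neg_one_powi)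
  qed
  \<comment> \<open>These contain \<open>mhat\<close> of a single argument.\<close>
  have "C 1 = 0" "R k = 0"
    using len unfolding C_def R_def form_mhat_propagate form_propagate_mhat by simp_all
  have "(\<Sum>j=1..k. (-1) powi w j * C j) = (\<Sum>i=1..k. (-1) powi u i * R i)"
    using sum.swap_restrict[of "{1..k}" "{1..k}" "\<lambda>j i. W i j" "\<lambda>j i. i < j"]
    by (simp add: column row sum_negf)
  moreover have "{1..k} = insert 1 (insert k {2..<k})"
    using \<open>k \<ge> 2\<close> by auto
  ultimately have "(-1) powi w k * C k = (-1) powi u 1 * R 1"
    using \<open>k \<ge> 2\<close> \<open>C 1 = 0\<close> \<open>R k = 0\<close> inner by simp
  then show ?thesis
    by (simp add: w_def u_def C_def R_def D_def neg_one_powi minus_one_power_iff)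
qed

lemma transferred_cyclic: "cyclic (pairing integral) (harmonic h) (transferred h)"
  unfolding cyclic_def
proof (intro allI impI)
  fix k :: nat and x :: "nat \<Rightarrow> 'b" and \<delta> :: "nat \<Rightarrow> int"
  assume "2 \<le> k" and "\<forall>i\<in>{1..k + 1}. x i \<in> harmonic h \<inter> A (\<delta> i)"
  then have harmonic: "x i \<in> harmonic h" and degree: "x i \<in> A (\<delta> i)" if "i \<in> {1..k + 1}" for i
    using that by auto
  define ys where "ys = map (\<lambda>i. (\<delta> i, x i)) [1..<k + 2]"
  have len: "length ys = k + 1" and hom: "homogeneous ys" and "ys \<noteq> []"
    using degree by (auto simp: ys_def)
  have hom_take: "homogeneous (take k ys)" and hom_drop: "homogeneous (drop 1 ys)"
    using hom by (meson in_set_takeD in_set_dropD)+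
  have first: "take k ys = map (\<lambda>i. (\<delta> i, x i)) [1..<k + 1]" "drop k ys = [(\<delta> (k + 1), x (k + 1))]"
    by (simp_all add: ys_def take_map drop_map)
  have last: "take 1 ys = [(\<delta> 1, x 1)]" "drop 1 ys = map (\<lambda>i. (\<delta> i, x i)) [2..<k + 2]"
    by (simp_all add: ys_def take_map drop_map upt_conv_Cons numeral_2_eq_2 del: upt_Suc)
  have transferred: "transferred h (map x js) = \<pi> (mhat h (map (\<lambda>i. (\<delta> i, x i)) js))"
    if "set js \<subseteq> {1..k + 1}" for js
  proof -
    have "list_all2 (\<lambda>x i. x \<in> A i) (map x js) (map \<delta> js)"
      using degree that by (auto simp: list_all2_conv_all_nth subset_eq)
    then show ?thesis
      by (simp add: transferred_homogeneous zip_map_map zip_same_conv_map comp_def)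
  qed
  have left: "\<langle>transferred h (map x [1..<k + 1]), x (k + 1)\<rangle> = \<langle>mhat h (take k ys), x (k + 1)\<rangle>"
  proof -
    have "transferred h (map x [1..<k + 1]) = \<pi> (mhat h (take k ys))"
      unfolding first(1) by (rule transferred) auto
    then show ?thesis
      using form_proj_harmonic[OF mhat_degree[OF hom_take] degree harmonic, of "k + 1"] \<open>ys \<noteq> []\<close> \<open>2 \<le> k\<close>
      by auto
  qed
  have right: "\<langle>transferred h (map x [2..<k + 2]), x 1\<rangle> = \<langle>mhat h (drop 1 ys), x 1\<rangle>"
  proof -
    have "transferred h (map x [2..<k + 2]) = \<pi> (mhat h (drop 1 ys))"
      unfolding last(2) by (rule transferred) auto
    then show ?thesis
      using form_proj_harmonic[OF mhat_degree[OF hom_drop] degree harmonic, of 1] len \<open>2 \<le> k\<close>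
      by auto
  qed
  have "(-1) ^ k * \<langle>mhat h (take k ys), x (k + 1)\<rangle> =
      (-1) powi (int k * \<delta> 1) * \<langle>x 1, mhat h (drop 1 ys)\<rangle>"
    using mhat_cyclic[OF hom len \<open>2 \<le> k\<close>, unfolded first(2) last(1)]
    by (simp add: propagate_singleton functional_neg[OF functional_form_left]
        functional_neg[OF functional_form_right] del: drop_Suc)
  moreover have "\<langle>x 1, mhat h (drop 1 ys)\<rangle> =
      (-1) powi (\<delta> 1 * ((\<Sum>i=2..k + 1. \<delta> i) + 2 - int k)) * \<langle>mhat h (drop 1 ys), x 1\<rangle>"
  proof -
    have "deg (drop 1 ys) = (\<Sum>i=2..k + 1. \<delta> i)"
      unfolding last(2) using atLeastLessThanSuc_atLeastAtMost[of 2 "k + 1"]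
      by (simp add: comp_def interv_sum_list_conv_sum_set_nat del: upt_Suc)
    moreover have "length (drop 1 ys) = k" "drop 1 ys \<noteq> []"
      using len \<open>2 \<le> k\<close> by auto
    ultimately show ?thesis
      using form_commute[OF degree mhat_degree[OF hom_drop], of 1] by simp
  qed
  ultimately have rotate: "(-1) ^ k * \<langle>mhat h (take k ys), x (k + 1)\<rangle> =
      (-1) powi (int k * \<delta> 1) *
        ((-1) powi (\<delta> 1 * ((\<Sum>i=2..k + 1. \<delta> i) + 2 - int k)) * \<langle>mhat h (drop 1 ys), x 1\<rangle>)"
    by (simp only:)
  \<comment> \<open>Moving \<open>x 1\<close> to the right produces the sign \<open>(-1)\<close> to the power
    \<open>\<delta> 1 * k\<close> beyond the Koszul sign, since \<open>mhat\<close> has degree \<open>2 - k\<close>; it cancels the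
    factor in \<open>rotate\<close>.\<close>
  have "a = (-1) ^ k * (-1) powi (\<delta> 1 * s) * b"
    if "(-1) ^ k * a = (-1) powi (int k * \<delta> 1) * ((-1) powi (\<delta> 1 * (s + 2 - int k)) * b)"
    for a b :: 'a and s :: int
    using that by (auto simp: neg_one_powi minus_one_power_iff minus_equation_iff[of a] split: if_splits)
  from this[OF rotate] show "\<langle>transferred h (map x [1..<k + 1]), x (k + 1)\<rangle> =
      (-1) ^ k * (-1) powi (\<delta> 1 * (\<Sum>i=2..k + 1. \<delta> i)) *
        \<langle>transferred h (map x [2..<k + 2]), x 1\<rangle>"
    unfolding left right .
qed

end

theorem theorem3p3:
  fixes scale :: "'f::field_char_0 \<Rightarrow> 'a::{ring, monoid_mult} \<Rightarrow> 'a"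
    and n :: nat
    and A :: "int \<Rightarrow> 'a set"
    and d :: "'a \<Rightarrow> 'a"
    and integral :: "'a set \<Rightarrow> 'f"
    and h :: "'a \<Rightarrow> 'a"
  assumes "poincare_dgca scale n A d integral"
    and "hodge_homotopy scale n A d integral h"
  shows "dgca.minimal_operations scale A (dgca.harmonic d h) (dgca.transferred scale n A d h) \<and>
         dgca.strictly_unital (dgca.harmonic d h) (dgca.transferred scale n A d h) \<and>
         dgca.cyclic A (dgca.pairing n A d integral) (dgca.harmonic d h)
           (dgca.transferred scale n A d h)"
proof -
  interpret hodge_homotopy scale n A d integral h
    by fact
  show ?thesis
    using transferred_minimal transferred_unital transferred_cyclic by blast
qed

end
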